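(* Let $K$ be a field of characteristic zero and let $\mathcal{DX}$ be the set of linear operators $Q\colon K[x]\to K[x]$ that have a DX-expansion $Q=\sum_{k=0}^\infty f_k(D)X^k$ with $f_k\in K[[t]]$ and the sum converging in the discrete topology. Then $\mathcal{DX}$ is a (noncommutative, unital) $K$-subalgebra of the algebra of all linear operators on $K[x]$ under composition, addition and scalar multiplication; in particular it is closed under composition.
   Context: $D$ is differentiation and $X$ multiplication by $x$; $f(D)=\sum_jc_jD^j$ for $f=\sum_jc_jt^j$. Convergence in the discrete topology means that for every polynomial $p$ only finitely many terms $f_k(D)X^kp$ are nonzero. *)

theory Defs
  imports
    "HOL-Algebra.Embedded_Algebras"
    "HOL-Computational_Algebra.Formal_Power_Series"
    "HOL-Computational_Algebra.Polynomial"
    "HOL-Library.Groups_Big_Fun"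
begin

hide_const (open) Module.smult

definition lin_ops :: "('a::field poly \<Rightarrow> 'a poly) set"
  where "lin_ops = {Q. Vector_Spaces.linear smult smult Q}"

definition lin_op_ring :: "('a::field poly \<Rightarrow> 'a poly) ring"
  where "lin_op_ring =
    \<lparr>carrier = lin_ops,
     monoid.mult = (\<lambda>P Q. P \<circ> Q),
     one = id,
     ring.zero = (\<lambda>p. 0),
     add = (\<lambda>P Q p. P p + Q p)\<rparr>"

text \<open>
  The embedded copy of the field in its operator algebra. Since
  \<open>smult c \<circ> Q = (\<lambda>p. smult c (Q p))\<close>, multiplication by these elements is scalar
  multiplication of operators.
\<close>
definition scalar_ops :: "('a::field poly \<Rightarrow> 'a poly) set"
  where "scalar_ops = range smult"

lemma lin_ops_iff:
  "Q \<in> lin_ops \<longleftrightarrow> (\<forall>p q. Q (p + q) = Q p + Q q) \<and> (\<forall>c p. Q (smult c p) = smult c (Q p))"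
  for Q :: "'a::field poly \<Rightarrow> 'a poly"
proof -
  have v: "vector_space (smult :: 'a \<Rightarrow> 'a poly \<Rightarrow> 'a poly)"
    by unfold_locales (simp_all add: smult_add_right smult_add_left)
  show ?thesis
    using v by (auto simp: lin_ops_def Vector_Spaces.linear_def module_hom_def
        module_hom_axioms_def vector_space_def Modules.module_def smult_add_right smult_add_left)
qed

lemma lin_op_ring_embedded_algebra:
  "embedded_algebra (scalar_ops :: ('a::field poly \<Rightarrow> 'a poly) set) lin_op_ring"
proof -
  have neg: "\<exists>P\<in>lin_ops. \<forall>p. P p + Q p = 0" if "Q \<in> lin_ops"
    for Q :: "'a poly \<Rightarrow> 'a poly"
    using that by (intro bexI[of _ "\<lambda>p. - Q p"]) (auto simp: lin_ops_iff)
  interpret ring "lin_op_ring :: ('a poly \<Rightarrow> 'a poly) ring"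
  proof (intro ringI abelian_groupI monoidI)
    fix Q assume "Q \<in> carrier (lin_op_ring :: ('a poly \<Rightarrow> 'a poly) ring)"
    then show "\<exists>P\<in>carrier lin_op_ring. P \<oplus>\<^bsub>lin_op_ring\<^esub> Q = \<zero>\<^bsub>lin_op_ring\<^esub>"
      using neg by (auto simp: lin_op_ring_def fun_eq_iff)
  qed (auto simp: lin_op_ring_def lin_ops_iff fun_eq_iff ac_simps smult_add_right)
  have sub: "subring scalar_ops (lin_op_ring :: ('a poly \<Rightarrow> 'a poly) ring)"
  proof (rule subringI)
    show "scalar_ops \<subseteq> carrier (lin_op_ring :: ('a poly \<Rightarrow> 'a poly) ring)"
      by (auto simp: lin_op_ring_def lin_ops_iff scalar_ops_def smult_add_right mult.commute)
    show "\<one>\<^bsub>lin_op_ring\<^esub> \<in> (scalar_ops :: ('a poly \<Rightarrow> 'a poly) set)"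
      by (auto simp: lin_op_ring_def scalar_ops_def image_iff fun_eq_iff intro!: exI[of _ 1])
    fix P assume P: "P \<in> (scalar_ops :: ('a poly \<Rightarrow> 'a poly) set)"
    then obtain c where c: "P = smult c" by (auto simp: scalar_ops_def)
    have "\<ominus>\<^bsub>lin_op_ring\<^esub> P = smult (- c)"
      by (rule minus_equality)
        (auto simp: c lin_op_ring_def lin_ops_iff fun_eq_iff smult_add_right mult.commute)
    then show "\<ominus>\<^bsub>lin_op_ring\<^esub> P \<in> scalar_ops" by (simp add: scalar_ops_def)
    fix Q assume Q: "Q \<in> (scalar_ops :: ('a poly \<Rightarrow> 'a poly) set)"
    then obtain d where d: "Q = smult d" by (auto simp: scalar_ops_def)
    show "P \<otimes>\<^bsub>lin_op_ring\<^esub> Q \<in> scalar_ops"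
      by (auto simp: c d lin_op_ring_def scalar_ops_def image_iff fun_eq_iff
          intro!: exI[of _ "c * d"])
    show "P \<oplus>\<^bsub>lin_op_ring\<^esub> Q \<in> scalar_ops"
      by (auto simp: c d lin_op_ring_def scalar_ops_def image_iff fun_eq_iff smult_add_left
          intro!: exI[of _ "c + d"])
  qed
  have "subfield scalar_ops (lin_op_ring :: ('a poly \<Rightarrow> 'a poly) ring)"
  proof (rule subfieldI)
    show "subcring scalar_ops (lin_op_ring :: ('a poly \<Rightarrow> 'a poly) ring)"
      by (rule subcringI[OF sub])
        (auto simp: scalar_ops_def lin_op_ring_def fun_eq_iff mult.commute)
    show "Units (lin_op_ring \<lparr>carrier := scalar_ops\<rparr>) =
      (scalar_ops :: ('a poly \<Rightarrow> 'a poly) set) - {\<zero>\<^bsub>lin_op_ring\<^esub>}"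
    proof (intro equalityI subsetI)
      fix P assume "P \<in> Units (lin_op_ring \<lparr>carrier := scalar_ops :: ('a poly \<Rightarrow> 'a poly) set\<rparr>)"
      then obtain Q where "P \<in> scalar_ops" "Q \<in> scalar_ops" "P \<circ> Q = id"
        by (auto simp: Units_def lin_op_ring_def)
      moreover have "P \<noteq> (\<lambda>p. 0)"
      proof
        assume "P = (\<lambda>p. 0)"
        with \<open>P \<circ> Q = id\<close> have "(0 :: 'a poly) = 1"
          by (metis comp_apply id_apply)
        then show False by simp
      qed
      ultimately show "P \<in> scalar_ops - {\<zero>\<^bsub>lin_op_ring\<^esub>}"
        by (simp add: lin_op_ring_def)
    next
      fix P assume "P \<in> (scalar_ops :: ('a poly \<Rightarrow> 'a poly) set) - {\<zero>\<^bsub>lin_op_ring\<^esub>}"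
      then obtain c where c: "P = smult c" and "P \<noteq> (\<lambda>p. 0)"
        by (auto simp: scalar_ops_def lin_op_ring_def)
      then have "c \<noteq> 0" by (auto simp: fun_eq_iff)
      have "smult (inverse c) \<in> (scalar_ops :: ('a poly \<Rightarrow> 'a poly) set)"
        by (simp add: scalar_ops_def)
      moreover have "P \<circ> smult (inverse c) = id" "smult (inverse c) \<circ> P = id"
        using c \<open>c \<noteq> 0\<close> by (auto simp: fun_eq_iff)
      ultimately show "P \<in> Units (lin_op_ring \<lparr>carrier := scalar_ops\<rparr>)"
        using c by (auto simp: Units_def lin_op_ring_def scalar_ops_def)
    qed
  qed
  then show ?thesis
    by (simp add: embedded_algebra_def ring_axioms)
qed

definition op_X :: "'a::field poly \<Rightarrow> 'a poly"
  where "op_X p = [:0, 1:] * p"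

text \<open>
  For a power series \<open>f\<close> this is the operator \<open>f(D)\<close>, with \<open>pderiv\<close> for \<open>D\<close>.
  \<open>Sum_any\<close> adds up the nonzero terms and defaults to \<open>0\<close> if there are infinitely many
  of them, which does not happen here.
\<close>
definition fps_D :: "'a::field fps \<Rightarrow> 'a poly \<Rightarrow> 'a poly"
  where "fps_D f p = Sum_any (\<lambda>j. smult (fps_nth f j) ((pderiv ^^ j) p))"

lemma finite_fps_D_terms:
  "finite {j. smult (fps_nth f j) ((pderiv ^^ j) p) \<noteq> 0}" for p :: "'a::field_char_0 poly"
proof (rule finite_subset)
  have "(pderiv ^^ j) p = 0" if "degree p < j" for j
    by (rule poly_eqI) (use that in \<open>simp add: coeff_higher_pderiv coeff_eq_0\<close>)
  then show "{j. smult (fps_nth f j) ((pderiv ^^ j) p) \<noteq> 0} \<subseteq> {..degree p}"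
    by (force simp: not_le[symmetric])
qed simp

definition DX_converges :: "(nat \<Rightarrow> 'a::field fps) \<Rightarrow> bool"
  where "DX_converges f \<longleftrightarrow> (\<forall>p. finite {k. fps_D (f k) ((op_X ^^ k) p) \<noteq> 0})"

definition DX_expansion :: "(nat \<Rightarrow> 'a::field fps) \<Rightarrow> ('a poly \<Rightarrow> 'a poly) \<Rightarrow> bool"
  where "DX_expansion f Q \<longleftrightarrow>
    DX_converges f \<and> (\<forall>p. Q p = Sum_any (\<lambda>k. fps_D (f k) ((op_X ^^ k) p)))"

definition DX :: "('a::field poly \<Rightarrow> 'a poly) set"
  where "DX = {Q \<in> lin_ops. \<exists>f. DX_expansion f Q}"

text \<open>
  The library locale \<^locale>\<open>subalgebra\<close> only demands an additive subgroup closed under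
  scalars, i.e. a subspace; closure under the ring multiplication and the presence of the unit
  come from \<^locale>\<open>subring\<close>.
\<close>
definition unital_subalgebra :: "'b set \<Rightarrow> 'b set \<Rightarrow> 'b ring \<Rightarrow> bool"
  where "unital_subalgebra K A R \<longleftrightarrow> subring A R \<and> subalgebra K A R"

end

(* Q lies in DX iff it is linear, raises degrees by at most some N, and, for every integer d, the
   coefficient of x^(n-d) in Q x^n is given by a polynomial in n. Indeed D^j X^k x^n equals
   (n-j+k+1) ... (n+k) x^(n-j+k), convergence says that for each j - k only finitely many
   terms occur, and these products over k form a Newton basis. In this description closure under
   composition is a Cauchy product. *)
theory Submission
  imports Defs
begin

section \<open>Linear operators and their determination by monomials\<close>

lemma lin_opsI:
  assumes "\<And>p q. Q (p + q) = Q p + Q q" and "\<And>c p. Q (smult c p) = smult c (Q p)"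
  shows "Q \<in> lin_ops"
  using assms by (simp add: lin_ops_iff)

lemma lin_ops_add: "Q \<in> lin_ops \<Longrightarrow> Q (p + q) = Q p + Q q"
  by (simp add: lin_ops_iff)

lemma lin_ops_smult: "Q \<in> lin_ops \<Longrightarrow> Q (smult c p) = smult c (Q p)"
  by (simp add: lin_ops_iff)

lemma lin_ops_0: "Q \<in> lin_ops \<Longrightarrow> Q 0 = 0"
  using lin_ops_smult[of Q 0 0] by simp

lemma lin_ops_sum: "Q \<in> lin_ops \<Longrightarrow> Q (\<Sum>i\<in>A. g i) = (\<Sum>i\<in>A. Q (g i))"
  by (induction A rule: infinite_finite_induct) (auto simp: lin_ops_0 lin_ops_add)

lemma smult_sum_right: "smult c (\<Sum>i\<in>A. g i) = (\<Sum>i\<in>A. smult c (g i))"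
  by (induction A rule: infinite_finite_induct) (auto simp: smult_add_right)

lemma lin_ops_comp: "P \<in> lin_ops \<Longrightarrow> Q \<in> lin_ops \<Longrightarrow> P \<circ> Q \<in> lin_ops"
  by (simp add: lin_ops_iff)

lemma lin_ops_funpow: "Q \<in> lin_ops \<Longrightarrow> Q ^^ n \<in> lin_ops"
  by (induction n) (auto simp: lin_ops_iff)

lemma poly_monom_induct [case_names add smult monom]:
  fixes p :: "'a::comm_semiring_1 poly"
  assumes "\<And>p q. P p \<Longrightarrow> P q \<Longrightarrow> P (p + q)" and "\<And>c p. P p \<Longrightarrow> P (smult c p)"
    and "\<And>n. P (monom 1 n)"
  shows "P p"
proof -
  have m: "P (monom c n)" for c n
    using assms(2)[of "monom 1 n" c] assms(3)[of n] by (simp add: smult_monom)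
  have z: "P 0" using m[of 0 0] by simp
  have "P (\<Sum>i\<in>A. monom (coeff p i) i)" for A
    by (induction A rule: infinite_finite_induct) (auto intro: z m assms(1))
  from this[of "{..degree p}"] show ?thesis by (simp add: poly_as_sum_of_monoms)
qed

lemma lin_ops_eqI:
  assumes "P \<in> lin_ops" "Q \<in> lin_ops" "\<And>n. P (monom 1 n) = Q (monom 1 n)"
  shows "P = Q"
proof
  fix p show "P p = Q p"
    by (induction p rule: poly_monom_induct)
      (use assms in \<open>simp_all add: lin_ops_add lin_ops_smult\<close>)
qed

section \<open>The operators X, D and f(D) on monomials\<close>

lemma op_X_lin_ops: "op_X \<in> lin_ops"
  by (simp add: lin_ops_iff op_X_def algebra_simps smult_add_right)

lemma op_X_power_monom: "(op_X ^^ k) (monom c n) = monom c (n + k)"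
  by (induction k) (simp_all add: op_X_def monom_Suc)

lemma pderiv_lin_ops: "pderiv \<in> lin_ops"
  by (simp add: lin_ops_iff pderiv_add pderiv_smult)

lemma fps_D_eq_sum:
  fixes p :: "'a::field_char_0 poly"
  assumes "degree p \<le> m"
  shows "fps_D f p = (\<Sum>j\<le>m. smult (fps_nth f j) ((pderiv ^^ j) p))"
  unfolding fps_D_def
proof (rule Sum_any.expand_superset)
  have "(pderiv ^^ j) p = 0" if "degree p < j" for j
    by (rule poly_eqI) (use that in \<open>simp add: coeff_higher_pderiv coeff_eq_0\<close>)
  then show "{j. smult (fps_nth f j) ((pderiv ^^ j) p) \<noteq> 0} \<subseteq> {..m}"
    using assms by (force simp: not_le[symmetric])
qed simp

lemma fps_D_lin_ops: "fps_D f \<in> (lin_ops :: ('a::field_char_0 poly \<Rightarrow> 'a poly) set)"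
proof (rule lin_opsI)
  fix p q :: "'a poly" and c :: 'a
  \<comment> \<open>A common degree bound turns \<open>fps_D\<close> of every polynomial involved
    into a sum over the same finite range.\<close>
  define m where "m = max (degree p) (degree q)"
  have "degree p \<le> m" "degree q \<le> m" "degree (p + q) \<le> m" "degree (smult c p) \<le> m"
    by (auto simp: m_def degree_add_le max.coboundedI1)
  note eqs = this[THEN fps_D_eq_sum]
  note lin = lin_ops_funpow[OF pderiv_lin_ops]
  show "fps_D f (p + q) = fps_D f p + fps_D f q"
    by (simp add: eqs lin_ops_add[OF lin] smult_add_right sum.distrib)
  show "fps_D f (smult c p) = smult c (fps_D f p)"
    by (simp add: eqs lin_ops_smult[OF lin] smult_sum_right mult.commute)
qed

text \<open>Among the terms of f(D), only the one with \<open>j = m - r\<close> sends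
  \<open>x^m\<close> to a multiple of \<open>x^r\<close>; the factor is \<open>m!/r!\<close>,
  written as a rising factorial.\<close>

lemma coeff_fps_D_monom:
  "coeff (fps_D f (monom (1::'a::field_char_0) m)) r =
    (if r \<le> m then fps_nth f (m - r) * pochhammer (of_nat (Suc r)) (m - r) else 0)"
proof -
  have "coeff (fps_D f (monom (1::'a) m)) r =
      (\<Sum>j\<le>m. fps_nth f j * (pochhammer (of_nat (Suc r)) j * (if m = r + j then 1 else 0)))"
    by (simp add: fps_D_eq_sum[OF degree_monom_le] coeff_sum coeff_higher_pderiv)
  also have "\<dots> = (\<Sum>j\<le>m. if j = m - r \<and> r \<le> m
      then fps_nth f (m - r) * pochhammer (of_nat (Suc r)) (m - r) else 0)"
    by (rule sum.cong) auto
  finally show ?thesis by (auto simp: sum.delta)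
qed

text \<open>In characteristic zero the \<open>D^j x^m\<close> with \<open>j \<le> m\<close> are
  nonzero multiples of distinct monomials, so nothing can cancel.\<close>

lemma fps_D_monom_eq_0_iff:
  "fps_D f (monom (1::'a::field_char_0) m) = 0 \<longleftrightarrow> (\<forall>j\<le>m. fps_nth f j = 0)"
proof
  assume 0: "fps_D f (monom (1::'a) m) = 0"
  show "\<forall>j\<le>m. fps_nth f j = 0"
  proof (intro allI impI)
    fix j assume "j \<le> m"
    have "pochhammer (of_nat (Suc (m - j)) :: 'a) j \<noteq> 0"
      using pochhammer_pos[of "Suc (m - j)" j] by (simp add: pochhammer_of_nat del: of_nat_Suc)
    then show "fps_nth f j = 0"
      using coeff_fps_D_monom[of f m "m - j"] 0 \<open>j \<le> m\<close> by simp
  qed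
next
  assume "\<forall>j\<le>m. fps_nth f j = 0"
  then show "fps_D f (monom (1::'a) m) = 0"
    by (intro poly_eqI) (simp add: coeff_fps_D_monom)
qed

section \<open>Convergence and coefficients of DX-sums\<close>

lemma fps_D_op_X_power_lin_ops:
  "(\<lambda>p. fps_D f ((op_X ^^ k) p)) \<in> (lin_ops :: ('a::field_char_0 poly \<Rightarrow> 'a poly) set)"
  using lin_ops_comp[OF fps_D_lin_ops lin_ops_funpow[OF op_X_lin_ops]] by (simp add: comp_def)

text \<open>By linearity it suffices to test monomials. On \<open>x^n\<close> the term of index
  \<open>k\<close> is \<open>f k\<close> in D applied to \<open>x^(n+k)\<close>, which is zero
  exactly when the order of \<open>f k\<close> exceeds \<open>n + k\<close>.\<close>

lemma DX_converges_iff: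
  "DX_converges f \<longleftrightarrow>
    (\<forall>n. \<exists>K. \<forall>k\<ge>K. \<forall>j\<le>n + k. fps_nth (f k) j = (0::'a::field_char_0))"
proof -
  note lin = fps_D_op_X_power_lin_ops
  have "DX_converges f \<longleftrightarrow> (\<forall>n. finite {k. fps_D (f k) ((op_X ^^ k) (monom 1 n)) \<noteq> 0})"
    (is "_ \<longleftrightarrow> ?R")
  proof
    assume R: ?R
    have "finite {k. fps_D (f k) ((op_X ^^ k) p) \<noteq> 0}" for p
    proof (induction p rule: poly_monom_induct)
      case (add p q)
      show ?case
        by (rule finite_subset[OF _ finite_UnI[OF add]]) (auto simp: lin_ops_add[OF lin])
    next
      case (smult c p)
      show ?case
        by (rule finite_subset[OF _ smult]) (auto simp: lin_ops_smult[OF lin])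
    qed (use R in auto)
    then show "DX_converges f" by (simp add: DX_converges_def)
  qed (simp add: DX_converges_def)
  also have "\<dots> \<longleftrightarrow> (\<forall>n. \<exists>K. \<forall>k\<ge>K. \<forall>j\<le>n + k. fps_nth (f k) j = 0)"
  proof -
    have "finite {k. \<not> P k} \<longleftrightarrow> (\<exists>K. \<forall>k\<ge>K. P k)" for P :: "nat \<Rightarrow> bool"
      by (metis (mono_tags, lifting) MOST_nat_le eventually_cofinite)
    then show ?thesis by (simp add: op_X_power_monom fps_D_monom_eq_0_iff del: not_all)
  qed
  finally show ?thesis .
qed

lemma DX_sum_lin_ops:
  assumes "DX_converges f"
  shows "(\<lambda>p. Sum_any (\<lambda>k. fps_D (f k) ((op_X ^^ k) p)))
    \<in> (lin_ops :: ('a::field_char_0 poly \<Rightarrow> 'a poly) set)"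
proof (rule lin_opsI)
  fix p q :: "'a poly" and c :: 'a
  note lin = fps_D_op_X_power_lin_ops
  have fin: "finite {k. fps_D (f k) ((op_X ^^ k) p) \<noteq> 0}" for p
    using assms by (simp add: DX_converges_def)
  show "Sum_any (\<lambda>k. fps_D (f k) ((op_X ^^ k) (p + q))) =
      Sum_any (\<lambda>k. fps_D (f k) ((op_X ^^ k) p)) + Sum_any (\<lambda>k. fps_D (f k) ((op_X ^^ k) q))"
    by (simp add: lin_ops_add[OF lin] Sum_any.distrib fin)
  \<comment> \<open>The support for \<open>p\<close> serves as index set because that for
    \<open>smult c p\<close> shrinks when \<open>c = 0\<close>.\<close>
  have "Sum_any (\<lambda>k. fps_D (f k) ((op_X ^^ k) (smult c p))) =
      (\<Sum>k\<in>{k. fps_D (f k) ((op_X ^^ k) p) \<noteq> 0}. smult c (fps_D (f k) ((op_X ^^ k) p)))"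
    unfolding lin_ops_smult[OF lin] by (rule Sum_any.expand_superset) (auto simp: fin)
  then show "Sum_any (\<lambda>k. fps_D (f k) ((op_X ^^ k) (smult c p))) =
      smult c (Sum_any (\<lambda>k. fps_D (f k) ((op_X ^^ k) p)))"
    by (simp add: Sum_any.expand_set smult_sum_right)
qed

text \<open>Finite support excludes the default value 0 of \<open>Sum_any\<close>, which could
  differ from the coefficientwise sums.\<close>

lemma coeff_Sum_any:
  "finite {k. g k \<noteq> 0} \<Longrightarrow> coeff (Sum_any g) r = Sum_any (\<lambda>k. coeff (g k) r)"
  unfolding Sum_any.expand_set[of g] coeff_sum
  by (rule sym, rule Sum_any.expand_superset) auto

text \<open>Only the \<open>D^j X^k\<close> with \<open>j = n + k - r\<close> reach
  \<open>x^r\<close>, so the cutoff \<open>K\<close> concerns these coefficients alone. A cutoff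
  depending only on \<open>n - r\<close> can thus serve all \<open>n\<close> at once.\<close>

lemma coeff_DX_sum_monom:
  fixes f :: "nat \<Rightarrow> 'a::field_char_0 fps"
  assumes "DX_converges f" and "\<And>k. k \<ge> K \<Longrightarrow> r \<le> n + k \<Longrightarrow> fps_nth (f k) (n + k - r) = 0"
  shows "coeff (Sum_any (\<lambda>k. fps_D (f k) ((op_X ^^ k) (monom 1 n)))) r =
    (\<Sum>k<K. if r \<le> n + k
      then fps_nth (f k) (n + k - r) * pochhammer (of_nat (Suc r)) (n + k - r) else 0)"
proof -
  have "coeff (Sum_any (\<lambda>k. fps_D (f k) ((op_X ^^ k) (monom 1 n)))) r =
      Sum_any (\<lambda>k. coeff (fps_D (f k) (monom 1 (n + k))) r)"
    using assms(1) by (simp add: coeff_Sum_any DX_converges_def flip: op_X_power_monom)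
  also have "\<dots> = (\<Sum>k<K. coeff (fps_D (f k) (monom 1 (n + k))) r)"
    by (rule Sum_any.expand_superset)
      (use assms(2) in \<open>auto simp: coeff_fps_D_monom not_le[symmetric] split: if_splits\<close>)
  finally show ?thesis by (simp add: coeff_fps_D_monom)
qed

section \<open>Graded expansions, and how a DX-expansion yields one\<close>

text \<open>
  The component of \<open>Q\<close> that changes degrees by \<open>N - i\<close> maps \<open>x^n\<close> to \<open>q i (n) x^(n+N-i)\<close>; the
  shift by \<open>N\<close> keeps the index natural. Polynomiality includes that \<open>q i\<close> vanishes at those \<open>n\<close>
  for which the exponent \<open>n+N-i\<close> would be negative.
\<close>
definition graded_expansion ::
  "nat \<Rightarrow> (nat \<Rightarrow> 'a::field poly) \<Rightarrow> ('a poly \<Rightarrow> 'a poly) \<Rightarrow> bool"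
  where "graded_expansion N q Q \<longleftrightarrow>
    (\<forall>n. \<forall>r>n + N. coeff (Q (monom 1 n)) r = 0) \<and>
    (\<forall>n i. poly (q i) (of_nat n) =
      (if i \<le> n + N then coeff (Q (monom 1 n)) (n + N - i) else 0))"

text \<open>At \<open>n\<close> this takes the value \<open>pochhammer (r + 1) m\<close>, where \<open>r = n + N - i\<close>.\<close>
definition shifted_pochhammer :: "nat \<Rightarrow> nat \<Rightarrow> nat \<Rightarrow> 'a::field_char_0 poly"
  where "shifted_pochhammer N i m = pochhammer [:1 + of_nat N - of_nat i, 1:] m"

lemma poly_shifted_pochhammer:
  "poly (shifted_pochhammer N i m) (x::'a::field_char_0) =
    pochhammer (1 + of_nat N - of_nat i + x) m"
  by (induction m) (simp_all add: shifted_pochhammer_def pochhammer_Suc algebra_simps)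

lemma poly_shifted_pochhammer_eq:
  assumes "i \<le> n + N"
  shows "poly (shifted_pochhammer N i m) (of_nat n) =
    (pochhammer (of_nat (Suc (n + N - i))) m :: 'a::field_char_0)"
  using assms by (simp add: poly_shifted_pochhammer of_nat_diff algebra_simps)

text \<open>The factors are the consecutive integers from \<open>n + N - i + 1 \<le> 0\<close> to
  \<open>n + N - i + m \<ge> 0\<close>, so one of them is 0.\<close>

lemma poly_shifted_pochhammer_eq_0:
  assumes "n + N < i" and "i \<le> n + N + m"
  shows "poly (shifted_pochhammer N i m) (of_nat n) = (0::'a::field_char_0)"
proof -
  have "1 + of_nat N - of_nat i + of_nat n = - (of_nat (i - Suc (n + N)) :: 'a)"
    using assms by (simp add: of_nat_diff)
  moreover have "pochhammer (- of_nat (i - Suc (n + N)) :: 'a) m = 0"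
    by (rule pochhammer_of_nat_eq_0_lemma, use assms in simp)
  ultimately show ?thesis by (simp only: poly_shifted_pochhammer)
qed

text \<open>Component \<open>i\<close> collects the \<open>D^j X^k\<close> with
  \<open>j = k + i - N\<close>. Convergence at \<open>x^i\<close> leaves only finitely many
  \<open>k\<close>, and each contributes a polynomial in \<open>n\<close>.\<close>

lemma graded_expansion_if_DX_expansion:
  fixes Q :: "'a::field_char_0 poly \<Rightarrow> 'a poly"
  assumes "DX_expansion f Q"
  shows "\<exists>N q. graded_expansion N q Q"
proof -
  have conv: "DX_converges f"
    and Q: "Q p = Sum_any (\<lambda>k. fps_D (f k) ((op_X ^^ k) p))" for p
    using assms by (auto simp: DX_expansion_def)
  from conv obtain K where K: "\<And>n k j. k \<ge> K n \<Longrightarrow> j \<le> n + k \<Longrightarrow> fps_nth (f k) j = 0"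
    unfolding DX_converges_iff by metis
  \<comment> \<open>For \<open>k \<ge> K 0\<close> the order of \<open>f k\<close> exceeds
    \<open>k\<close>, so the term lowers degrees; a smaller \<open>k\<close> raises them by less
    than \<open>N\<close>.\<close>
  define N where "N = K 0"
  define q where "q i = (\<Sum>k<K i. if N \<le> k + i
      then smult (fps_nth (f k) (k + i - N)) (shifted_pochhammer N i (k + i - N)) else 0)" for i
  have "coeff (Q (monom 1 n)) r = 0" if "r > n + N" for n r
  proof -
    have "coeff (Q (monom 1 n)) r = (\<Sum>k<N. if r \<le> n + k
      then fps_nth (f k) (n + k - r) * pochhammer (of_nat (Suc r)) (n + k - r) else 0)"
      unfolding Q by (rule coeff_DX_sum_monom[OF conv]) (use that K[of 0] N_def in auto)
    then show ?thesis using that by (simp add: sum.neutral)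
  qed
  moreover have "poly (q i) (of_nat n) =
      (if i \<le> n + N then coeff (Q (monom 1 n)) (n + N - i) else 0)" for n i
  proof (cases "i \<le> n + N")
    case True
    \<comment> \<open>The index into \<open>f k\<close> is \<open>k + i - N \<le> i + k\<close>, so
      the cutoff \<open>K i\<close> works for every \<open>n\<close>.\<close>
    have "coeff (Q (monom 1 n)) (n + N - i) = (\<Sum>k<K i. if n + N - i \<le> n + k
      then fps_nth (f k) (n + k - (n + N - i)) *
        pochhammer (of_nat (Suc (n + N - i))) (n + k - (n + N - i)) else 0)"
      unfolding Q by (rule coeff_DX_sum_monom[OF conv], rule K) (use True in auto)
    also have "\<dots> = poly (q i) (of_nat n)"
      unfolding q_def poly_sum
    proof (rule sum.cong[OF refl])
      fix k
      have "n + N - i \<le> n + k \<longleftrightarrow> N \<le> k + i" "n + k - (n + N - i) = k + i - N"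
        using True by auto
      then show "(if n + N - i \<le> n + k
          then fps_nth (f k) (n + k - (n + N - i)) *
            pochhammer (of_nat (Suc (n + N - i))) (n + k - (n + N - i)) else 0) =
        poly (if N \<le> k + i
          then smult (fps_nth (f k) (k + i - N)) (shifted_pochhammer N i (k + i - N)) else 0)
          (of_nat n)"
        by (simp add: poly_shifted_pochhammer_eq[OF True] del: of_nat_Suc)
    qed
    finally show ?thesis using True by simp
  next
    \<comment> \<open>The exponent \<open>n + N - i\<close> would be negative; each rising factorial
      in \<open>q i\<close> then contains the factor 0.\<close>
    case False
    then show ?thesis
      by (auto simp: q_def poly_sum poly_shifted_pochhammer_eq_0 intro!: sum.neutral)
  qed
  ultimately show ?thesis unfolding graded_expansion_def by blast
qed

section \<open>Newton expansions and the recovery of the series \<open>f k\<close>\<close>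

lemma newton_expansion:
  fixes p :: "'a::field_char_0 poly"
  shows "\<exists>c. p = (\<Sum>m\<le>degree p. smult (c m) (pochhammer [:a, 1:] m))"
proof (induction "degree p" arbitrary: p rule: less_induct)
  case less
  show ?case
  proof (cases "degree p")
    case 0
    then obtain d where "p = [:d:]" by (rule degree_eq_zeroE)
    then show ?thesis by (intro exI[of _ "\<lambda>_. d"]) simp
  next
    case (Suc d)
    have deg: "degree (pochhammer [:a, 1:] m) = m \<and> lead_coeff (pochhammer [:a, 1:] m) = 1" for m
    proof (induction m)
      case (Suc m)
      have eq: "[:a, 1:] + of_nat m = [:a + of_nat m, 1:]" by (simp add: of_nat_poly)
      have "pochhammer [:a, 1:] m \<noteq> 0" using Suc by auto
      then show ?case
        using Suc lead_coeff_mult[of "pochhammer [:a, 1:] m" "[:a + of_nat m, 1:]"]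
        by (auto simp: pochhammer_Suc eq degree_mult_eq simp del: mult_pCons_right)
    qed simp
    \<comment> \<open>Rising factorials are monic of degree equal to their index, so the leading
      terms cancel.\<close>
    define g where "g = p - smult (lead_coeff p) (pochhammer [:a, 1:] (Suc d))"
    have "degree g < Suc d"
    proof (rule degree_lessI)
      show "\<forall>k\<ge>Suc d. coeff g k = 0"
      proof (intro allI impI)
        fix k assume "Suc d \<le> k"
        then consider "k = Suc d" | "k > Suc d" by linarith
        then show "coeff g k = 0"
        proof cases
          case 1
          then show ?thesis using deg[of "Suc d"] Suc unfolding g_def
            by (metis coeff_diff coeff_smult diff_self mult.right_neutral)
        next
          case 2
          then show ?thesis using deg[of "Suc d"] Suc by (simp add: g_def coeff_eq_0)
        qed
      qed
    qed simp
    with less Suc obtain c where c: "g = (\<Sum>m\<le>degree g. smult (c m) (pochhammer [:a, 1:] m))"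
      by metis
    \<comment> \<open>The degree may drop by more than one; the gap is filled with zeros.\<close>
    define c' where "c' m = (if m \<le> degree g then c m else if m = Suc d then lead_coeff p else 0)"
      for m
    have "(\<Sum>m\<le>d. smult (c' m) (pochhammer [:a, 1:] m)) = g"
      by (subst c, rule sum.mono_neutral_cong_right)
        (use \<open>degree g < Suc d\<close> in \<open>auto simp: c'_def\<close>)
    moreover have "c' (Suc d) = lead_coeff p"
      using \<open>degree g < Suc d\<close> by (simp add: c'_def)
    ultimately have "p = (\<Sum>m\<le>Suc d. smult (c' m) (pochhammer [:a, 1:] m))"
      by (simp add: g_def)
    then show ?thesis using Suc by auto
  qed
qed

text \<open>The Newton index \<open>m = k + i - N\<close> is the power of D paired with
  \<open>X^k\<close>. Rewriting the expansion over \<open>k \<ge> 0\<close> requires that the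
  coefficients with \<open>m + N < i\<close> vanish, and the prescribed zeros of \<open>p\<close>
  force this.\<close>

lemma shifted_newton_expansion:
  fixes p :: "'a::field_char_0 poly"
  assumes "\<And>n. n + N < i \<Longrightarrow> poly p (of_nat n) = 0"
  obtains c L where "p = (\<Sum>k<L. smult (c k)
      (if N \<le> k + i then shifted_pochhammer N i (k + i - N) else 0))"
    and "\<And>k. k \<ge> L \<Longrightarrow> c k = 0"
proof -
  obtain c0 where "p = (\<Sum>m\<le>degree p. smult (c0 m) (shifted_pochhammer N i m))"
    using newton_expansion unfolding shifted_pochhammer_def by blast
  moreover define c where "c m = (if m \<le> degree p then c0 m else 0)" for m
  ultimately have p: "p = (\<Sum>m\<le>degree p. smult (c m) (shifted_pochhammer N i m))" by simp
  have c0: "c m = 0" if "m + N < i" for m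
    using that
  proof (induction m rule: less_induct)
    case (less m)
    show ?case
    proof (cases "m \<le> degree p")
      case True
      \<comment> \<open>At this \<open>n\<close> all basis polynomials of index greater than \<open>m\<close> vanish.\<close>
      define n where "n = i - Suc (N + m)"
      have a: "1 + of_nat N - of_nat i + of_nat n = - (of_nat m :: 'a)"
        using less.prems by (simp add: n_def of_nat_diff)
      have "0 = poly p (of_nat n)"
        using assms[of n] less.prems by (simp add: n_def)
      also have "\<dots> = (\<Sum>l\<le>degree p. c l * pochhammer (- of_nat m) l)"
        by (subst p) (simp add: poly_sum poly_shifted_pochhammer a)
      also have "\<dots> = (\<Sum>l\<in>{m}. c l * pochhammer (- of_nat m) l)"
      proof (rule sum.mono_neutral_right)
        show "\<forall>l\<in>{..degree p} - {m}. c l * pochhammer (- of_nat m) l = 0"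
        proof
          fix l assume "l \<in> {..degree p} - {m}"
          \<comment> \<open>Lower indices drop out by the induction hypothesis.\<close>
          then consider "l < m" | "l > m" by fastforce
          then show "c l * pochhammer (- of_nat m) l = 0"
            by cases (use less in \<open>auto simp: pochhammer_of_nat_eq_0_lemma\<close>)
        qed
      qed (use True in auto)
      \<comment> \<open>The one remaining rising factorial, of \<open>-m\<close> at index
        \<open>m\<close>, is \<open>(-1)^m m!\<close> and hence nonzero.\<close>
      finally show ?thesis
        using pochhammer_of_nat_eq_0_lemma'[of m m] by (auto simp: pochhammer_of_nat_eq_0_iff)
    qed (simp add: c_def)
  qed
  \<comment> \<open>Every \<open>k = m + N - i\<close> with \<open>m \<le> degree p\<close> lies
    below this bound.\<close>
  define L where "L = Suc (degree p + N)"
  define c' where "c' k = (if N \<le> k + i then c (k + i - N) else 0)" for k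
  have "(\<Sum>k<L. smult (c' k)
      (if N \<le> k + i then shifted_pochhammer N i (k + i - N) else 0))
      = (\<Sum>k\<in>{k. k < L \<and> N \<le> k + i}. smult (c (k + i - N)) (shifted_pochhammer N i (k + i - N)))"
    by (rule sum.mono_neutral_cong_right) (auto simp: c'_def)
  also have "\<dots> = (\<Sum>m\<in>{m. m + N < L + i \<and> i \<le> m + N}.
      smult (c m) (shifted_pochhammer N i m))"
    by (rule sum.reindex_bij_witness[of _ "\<lambda>m. m + N - i" "\<lambda>k. k + i - N"]) auto
  \<comment> \<open>The index sets differ only where \<open>c\<close> vanishes: above
    \<open>degree p\<close> by its definition, and for \<open>m + N < i\<close> by
    \<open>c0\<close>.\<close>
  also have "\<dots> = (\<Sum>m\<le>degree p. smult (c m) (shifted_pochhammer N i m))"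
  proof (rule sum.mono_neutral_cong)
    show "finite {m. m + N < L + i \<and> i \<le> m + N}"
      by (rule finite_subset[of _ "{..L + i}"]) auto
    fix m assume "m \<in> {..degree p} - {m. m + N < L + i \<and> i \<le> m + N}"
    then show "smult (c m) (shifted_pochhammer N i m) = 0"
      using c0[of m] by (auto simp: L_def)
  qed (auto simp: c_def)
  finally have "p = (\<Sum>k<L. smult (c' k)
      (if N \<le> k + i then shifted_pochhammer N i (k + i - N) else 0))"
    using p by simp
  moreover have "c' k = 0" if "k \<ge> L" for k
    using that by (auto simp: c'_def c_def L_def)
  ultimately show thesis by (rule that)
qed

text \<open>The Newton coefficients of \<open>q i\<close> are taken as the coefficients of the
  \<open>D^j X^k\<close> with \<open>j = k + i - N\<close>, which reverses the passage from
  \<open>f\<close> to \<open>q\<close>.\<close>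

lemma DX_expansion_if_graded_expansion:
  fixes Q :: "'a::field_char_0 poly \<Rightarrow> 'a poly"
  assumes lin: "Q \<in> lin_ops" and Q: "graded_expansion N q Q"
  shows "\<exists>f. DX_expansion f Q"
proof -
  have "\<forall>i. \<exists>c L. q i = (\<Sum>k<L. smult (c k)
      (if N \<le> k + i then shifted_pochhammer N i (k + i - N) else 0))
      \<and> (\<forall>k\<ge>L. c k = 0)" (is "\<forall>i. \<exists>c L. ?P i c L")
  proof
    fix i
    have "poly (q i) (of_nat n) = 0" if "n + N < i" for n
      using Q that by (simp add: graded_expansion_def)
    then show "\<exists>c L. ?P i c L"
      by (rule shifted_newton_expansion[of N i "q i"]) (assumption, intro exI conjI allI impI)
  qed
  then obtain c L where
    q: "\<And>i. q i = (\<Sum>k<L i. smult (c i k)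
      (if N \<le> k + i then shifted_pochhammer N i (k + i - N) else 0))"
    and c: "\<And>i k. k \<ge> L i \<Longrightarrow> c i k = 0"
    unfolding choice_iff by auto
  \<comment> \<open>The term \<open>D^j X^k\<close> belongs to component
    \<open>i = j + N - k\<close>. If that is negative, the term would raise degrees by more than
    \<open>N\<close>, so its coefficient is 0.\<close>
  define f where "f k = Abs_fps (\<lambda>j. if k \<le> j + N then c (j + N - k) k else 0)" for k
  have conv: "DX_converges f"
    unfolding DX_converges_iff
  proof
    fix n
    \<comment> \<open>For \<open>j \<le> n + k\<close> only components \<open>i \<le> n + N\<close>
      occur; the sum of their cutoffs bounds each of them.\<close>
    have "fps_nth (f k) j = 0" if "k \<ge> (\<Sum>i\<le>n + N. L i)" "j \<le> n + k" for k j
    proof (cases "k \<le> j + N")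
      case True
      have "L (j + N - k) \<le> (\<Sum>i\<le>n + N. L i)"
        by (rule member_le_sum) (use that in auto)
      then show ?thesis using that by (simp add: f_def c)
    qed (simp add: f_def)
    then show "\<exists>K. \<forall>k\<ge>K. \<forall>j\<le>n + k. fps_nth (f k) j = 0" by blast
  qed
  have "Q = (\<lambda>p. Sum_any (\<lambda>k. fps_D (f k) ((op_X ^^ k) p)))"
  proof (rule lin_ops_eqI[OF lin DX_sum_lin_ops[OF conv]], rule poly_eqI)
    fix n r
    show "coeff (Q (monom 1 n)) r =
        coeff (Sum_any (\<lambda>k. fps_D (f k) ((op_X ^^ k) (monom 1 n)))) r"
    proof (cases "r \<le> n + N")
      case True
      define i where "i = n + N - r"
      have r: "r = n + N - i" and i: "i \<le> n + N" using True by (auto simp: i_def)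
      have "coeff (Q (monom 1 n)) r = poly (q i) (of_nat n)"
        using Q i r by (simp add: graded_expansion_def)
      also have "\<dots> = (\<Sum>k<L i. if r \<le> n + k
          then fps_nth (f k) (n + k - r) * pochhammer (of_nat (Suc r)) (n + k - r) else 0)"
        unfolding q poly_sum
      proof (rule sum.cong[OF refl])
        fix k
        have *: "r \<le> n + k \<longleftrightarrow> N \<le> k + i" "n + k - r = k + i - N" using i r by auto
        show "poly (smult (c i k)
      (if N \<le> k + i then shifted_pochhammer N i (k + i - N) else 0))
            (of_nat n) = (if r \<le> n + k
          then fps_nth (f k) (n + k - r) * pochhammer (of_nat (Suc r)) (n + k - r) else 0)"
          unfolding * by (simp add: f_def poly_shifted_pochhammer_eq[OF i] r del: of_nat_Suc)
      qed
      also have "\<dots> = coeff (Sum_any (\<lambda>k. fps_D (f k) ((op_X ^^ k) (monom 1 n)))) r"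
      proof (rule coeff_DX_sum_monom[OF conv, symmetric])
        fix k assume "L i \<le> k" "r \<le> n + k"
        moreover have "n + k - r + N - k = i" if "k \<le> n + k - r + N"
          using that \<open>r \<le> n + k\<close> by (simp add: i_def)
        ultimately show "fps_nth (f k) (n + k - r) = 0" by (simp add: f_def c)
      qed
      finally show ?thesis .
    next
      case False
      \<comment> \<open>For \<open>r > n + N\<close> the index \<open>j = n + k - r\<close>
        satisfies \<open>j + N < k\<close>, the default case of \<open>f\<close>, so already the
        cutoff 0 is admissible.\<close>
      have "coeff (Sum_any (\<lambda>k. fps_D (f k) ((op_X ^^ k) (monom 1 n)))) r =
        (\<Sum>k<0. if r \<le> n + k
          then fps_nth (f k) (n + k - r) * pochhammer (of_nat (Suc r)) (n + k - r) else 0)"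
        by (rule coeff_DX_sum_monom[OF conv]) (use False in \<open>auto simp: f_def\<close>)
      then show ?thesis using False Q by (simp add: graded_expansion_def)
    qed
  qed
  then show ?thesis using conv by (auto simp: DX_expansion_def)
qed

section \<open>Closure properties of DX in graded form\<close>

lemma DX_iff:
  "Q \<in> DX \<longleftrightarrow> Q \<in> lin_ops \<and> (\<exists>N q. graded_expansion N q Q)"
  for Q :: "'a::field_char_0 poly \<Rightarrow> 'a poly"
  unfolding DX_def
  using graded_expansion_if_DX_expansion DX_expansion_if_graded_expansion by blast

text \<open>Raising the degree bound by \<open>M\<close> prepends \<open>M\<close> zero components.
  This brings two expansions to a common bound before they are added.\<close>

lemma graded_expansion_shift:
  assumes "graded_expansion N q Q"
  shows "graded_expansion (M + N) (\<lambda>i. if i < M then 0 else q (i - M)) Q"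
  unfolding graded_expansion_def
proof (intro conjI allI impI)
  fix n i
  show "poly (if i < M then 0 else q (i - M)) (of_nat n) =
      (if i \<le> n + (M + N) then coeff (Q (monom 1 n)) (n + (M + N) - i) else 0)"
    using assms by (auto simp: graded_expansion_def ac_simps)
qed (use assms in \<open>auto simp: graded_expansion_def\<close>)

lemma graded_expansion_add:
  assumes "graded_expansion N p P" "graded_expansion N q Q"
  shows "graded_expansion N (\<lambda>i. p i + q i) (\<lambda>x. P x + Q x)"
  using assms by (simp add: graded_expansion_def)

lemma graded_expansion_smult:
  assumes "graded_expansion N q Q"
  shows "graded_expansion N (\<lambda>i. smult c (q i)) (\<lambda>x. smult c (Q x))"
  using assms by (simp add: graded_expansion_def)

text \<open>Component \<open>b\<close> of \<open>Q\<close> moves \<open>x^n\<close> to degree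
  \<open>n + N - b\<close>, where component \<open>i - b\<close> of \<open>P\<close> then acts. Its
  polynomial is therefore evaluated at \<open>n + N - b\<close>, which explains the
  \<open>pcompose\<close>.\<close>

lemma graded_expansion_comp:
  fixes P Q :: "'a::field_char_0 poly \<Rightarrow> 'a poly"
  assumes lin: "P \<in> lin_ops" and P: "graded_expansion M p P" and Q: "graded_expansion N q Q"
  shows "graded_expansion (M + N)
    (\<lambda>i. \<Sum>b\<le>i. pcompose (p (i - b)) [:of_nat N - of_nat b, 1:] * q b) (P \<circ> Q)"
proof -
  have P0: "coeff (P (monom 1 n)) r = 0" if "r > n + M" for n r
    using P that by (simp add: graded_expansion_def)
  have Pp: "poly (p i) (of_nat n) =
      (if i \<le> n + M then coeff (P (monom 1 n)) (n + M - i) else 0)" for n i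
    using P by (simp add: graded_expansion_def)
  have Q0: "coeff (Q (monom 1 n)) r = 0" if "r > n + N" for n r
    using Q that by (simp add: graded_expansion_def)
  have Qq: "poly (q i) (of_nat n) =
      (if i \<le> n + N then coeff (Q (monom 1 n)) (n + N - i) else 0)" for n i
    using Q by (simp add: graded_expansion_def)
  have PQ: "coeff (P (Q (monom 1 n))) r =
      (\<Sum>b\<le>n + N. poly (q b) (of_nat n) * coeff (P (monom 1 (n + N - b))) r)" for n r
  proof -
    have "degree (Q (monom 1 n)) \<le> n + N" using Q0 by (intro degree_le) auto
    then have "Q (monom 1 n) = (\<Sum>s\<le>n + N. smult (coeff (Q (monom 1 n)) s) (monom 1 s))"
      by (simp add: smult_monom poly_as_sum_of_monoms')
    from arg_cong[OF this, of P] have "P (Q (monom 1 n)) =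
        (\<Sum>s\<le>n + N. smult (coeff (Q (monom 1 n)) s) (P (monom 1 s)))"
      by (simp only: lin_ops_sum[OF lin] lin_ops_smult[OF lin])
    then have "coeff (P (Q (monom 1 n))) r =
        (\<Sum>s\<le>n + N. coeff (Q (monom 1 n)) s * coeff (P (monom 1 s)) r)"
      by (simp add: coeff_sum)
    also have "\<dots> = (\<Sum>b\<le>n + N. poly (q b) (of_nat n) * coeff (P (monom 1 (n + N - b))) r)"
      by (rule sum.reindex_bij_witness[of _ "\<lambda>b. n + N - b" "\<lambda>s. n + N - s"]) (auto simp: Qq)
    finally show ?thesis .
  qed
  show ?thesis
    unfolding graded_expansion_def
  proof (intro conjI allI impI)
    fix n r assume "r > n + (M + N)"
    then show "coeff ((P \<circ> Q) (monom 1 n)) r = 0"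
      by (auto simp: PQ P0 intro!: sum.neutral)
  next
    fix n i
    have "poly (\<Sum>b\<le>i. pcompose (p (i - b)) [:of_nat N - of_nat b, 1:] * q b) (of_nat n) =
        (\<Sum>b\<le>i. poly (p (i - b)) (of_nat N - of_nat b + of_nat n) * poly (q b) (of_nat n))"
      by (simp add: poly_sum poly_pcompose)
    also have "\<dots> = (\<Sum>b\<le>n + N. if i \<le> n + (M + N)
        then poly (q b) (of_nat n) * coeff (P (monom 1 (n + N - b))) (n + (M + N) - i) else 0)"
    proof (rule sum.mono_neutral_cong)
      fix b assume "b \<in> {..i} \<inter> {..n + N}"
      then have b: "b \<le> i" "b \<le> n + N" by auto
      have "of_nat N - of_nat b + of_nat n = (of_nat (n + N - b) :: 'a)"
        using b by (simp add: of_nat_diff)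
      then have "poly (p (i - b)) (of_nat N - of_nat b + of_nat n) =
          (if i - b \<le> n + N - b + M
            then coeff (P (monom 1 (n + N - b))) (n + N - b + M - (i - b)) else 0)"
        by (simp only: Pp)
      moreover have "i - b \<le> n + N - b + M \<longleftrightarrow> i \<le> n + (M + N)"
        "n + N - b + M - (i - b) = n + (M + N) - i"
        using b by auto
      ultimately show "poly (p (i - b)) (of_nat N - of_nat b + of_nat n) * poly (q b) (of_nat n) =
        (if i \<le> n + (M + N)
        then poly (q b) (of_nat n) * coeff (P (monom 1 (n + N - b))) (n + (M + N) - i) else 0)"
        by simp
    qed (auto simp: Qq P0)
    also have "\<dots> = (if i \<le> n + (M + N) then coeff ((P \<circ> Q) (monom 1 n)) (n + (M + N) - i) else 0)"
      by (simp add: PQ)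
    finally show "poly (\<Sum>b\<le>i. pcompose (p (i - b)) [:of_nat N - of_nat b, 1:] * q b) (of_nat n) =
      (if i \<le> n + (M + N) then coeff ((P \<circ> Q) (monom 1 n)) (n + (M + N) - i) else 0)" .
  qed
qed

lemma DX_comp:
  fixes P Q :: "'a::field_char_0 poly \<Rightarrow> 'a poly"
  assumes "P \<in> DX" "Q \<in> DX"
  shows "P \<circ> Q \<in> DX"
  using assms graded_expansion_comp lin_ops_comp unfolding DX_iff by blast

lemma DX_add:
  fixes P Q :: "'a::field_char_0 poly \<Rightarrow> 'a poly"
  assumes "P \<in> DX" "Q \<in> DX"
  shows "(\<lambda>x. P x + Q x) \<in> DX"
proof -
  from assms obtain M p N q where "graded_expansion M p P" "graded_expansion N q Q"
    by (auto simp: DX_iff)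
  from graded_expansion_shift[OF this(1), of N] graded_expansion_shift[OF this(2), of M]
  have "\<exists>N q. graded_expansion N q (\<lambda>x. P x + Q x)"
    by (metis add.commute graded_expansion_add)
  moreover have "(\<lambda>x. P x + Q x) \<in> lin_ops"
    using assms by (simp add: DX_iff lin_ops_iff smult_add_right)
  ultimately show ?thesis by (simp add: DX_iff)
qed

lemma DX_smult:
  fixes Q :: "'a::field_char_0 poly \<Rightarrow> 'a poly"
  assumes "Q \<in> DX"
  shows "(\<lambda>x. smult c (Q x)) \<in> DX"
proof -
  have "(\<lambda>x. smult c (Q x)) \<in> lin_ops"
    using assms by (simp add: DX_iff lin_ops_iff smult_add_right mult.commute)
  then show ?thesis using assms graded_expansion_smult unfolding DX_iff by blast
qed

section \<open>The unit, X and D, and the algebra structure\<close>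

lemma DX_id: "id \<in> (DX :: ('a::field_char_0 poly \<Rightarrow> 'a poly) set)"
proof -
  have "graded_expansion 0 (\<lambda>i. if i = 0 then 1 else 0) (id :: 'a poly \<Rightarrow> 'a poly)"
    by (auto simp: graded_expansion_def)
  then show ?thesis unfolding DX_iff by (auto simp: lin_ops_iff)
qed

lemma DX_op_X: "op_X \<in> (DX :: ('a::field_char_0 poly \<Rightarrow> 'a poly) set)"
proof -
  have "graded_expansion 1 (\<lambda>i. if i = 0 then 1 else 0) (op_X :: 'a poly \<Rightarrow> 'a poly)"
    using op_X_power_monom[of 1 "1::'a"] by (auto simp: graded_expansion_def)
  then show ?thesis using op_X_lin_ops unfolding DX_iff by blast
qed

text \<open>\<open>D x^n = n x^(n-1)\<close> has the single component polynomial \<open>x\<close>,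
  whose zero at 0 matches the missing exponent -1.\<close>

lemma DX_pderiv: "pderiv \<in> (DX :: ('a::field_char_0 poly \<Rightarrow> 'a poly) set)"
proof -
  have "graded_expansion 0 (\<lambda>i. if i = 1 then [:0, 1:] else 0) (pderiv :: 'a poly \<Rightarrow> 'a poly)"
    unfolding graded_expansion_def
    by (intro conjI allI impI) (simp_all add: pderiv_monom, presburger)
  then show ?thesis using pderiv_lin_ops unfolding DX_iff by blast
qed

lemma unital_subalgebra_DX:
  "unital_subalgebra scalar_ops (DX :: ('a::field_char_0 poly \<Rightarrow> 'a poly) set) lin_op_ring"
proof -
  let ?R = "lin_op_ring :: ('a poly \<Rightarrow> 'a poly) ring"
  interpret ring ?R
    using embedded_algebra.axioms(2)[OF lin_op_ring_embedded_algebra] .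
  have sub: "subring DX ?R"
  proof (rule subringI)
    show "DX \<subseteq> carrier ?R" by (auto simp: lin_op_ring_def DX_def)
    show "\<one>\<^bsub>?R\<^esub> \<in> DX" by (simp add: lin_op_ring_def DX_id)
    fix P Q :: "'a poly \<Rightarrow> 'a poly" assume P: "P \<in> DX"
    \<comment> \<open>Negation is multiplication by the scalar -1.\<close>
    have neg: "(\<lambda>x. - P x) \<in> DX" using DX_smult[OF P, of "- 1"] by simp
    have "\<ominus>\<^bsub>?R\<^esub> P = (\<lambda>x. - P x)"
      by (rule minus_equality) (use P neg in \<open>auto simp: lin_op_ring_def DX_def\<close>)
    then show "\<ominus>\<^bsub>?R\<^esub> P \<in> DX" using neg by simp
    assume "Q \<in> DX"
    then show "P \<otimes>\<^bsub>?R\<^esub> Q \<in> DX" "P \<oplus>\<^bsub>?R\<^esub> Q \<in> DX"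
      using P by (simp_all add: lin_op_ring_def DX_comp DX_add)
  qed
  moreover have "subalgebra scalar_ops DX ?R"
  proof -
    have "k \<otimes>\<^bsub>?R\<^esub> Q \<in> DX" if "k \<in> scalar_ops" "Q \<in> DX" for k Q
      using that DX_smult by (auto simp: lin_op_ring_def scalar_ops_def comp_def)
    then show ?thesis
      using sub by (simp add: subalgebra_def subalgebra_axioms_def subring_def)
  qed
  ultimately show ?thesis by (simp add: unital_subalgebra_def)
qed

theorem mainTheorem10:
  shows "unital_subalgebra scalar_ops (DX :: ('a::field_char_0 poly \<Rightarrow> 'a poly) set) lin_op_ring
    \<and> (\<forall>P \<in> (DX :: ('a poly \<Rightarrow> 'a poly) set). \<forall>Q \<in> DX. P \<circ> Q \<in> DX)
    \<and> (\<exists>P \<in> (DX :: ('a poly \<Rightarrow> 'a poly) set). \<exists>Q \<in> DX. P \<circ> Q \<noteq> Q \<circ> P)"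
proof -
  \<comment> \<open>Noncommutativity shows at the constant 1: \<open>DX\<close> fixes it, while
    \<open>XD\<close> sends it to 0.\<close>
  have "(pderiv \<circ> op_X) 1 \<noteq> (op_X \<circ> pderiv) (1 :: 'a poly)"
    by (simp add: op_X_def pderiv_pCons)
  then have "pderiv \<circ> op_X \<noteq> op_X \<circ> (pderiv :: 'a poly \<Rightarrow> 'a poly)" by metis
  then show ?thesis
    using unital_subalgebra_DX DX_comp DX_pderiv DX_op_X by blast
qed

end
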